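(* For every signed permutation $\pi\in\mathfrak{B}_n$, \[\mathfrak{d}_B(\pi)=\sum_{\substack{E\subseteq\{0,1,\dots,n-1\}\\ \operatorname{Pe}_B(\pi)\subseteq E\cup(E+1)\\ \pi(1)<0\ \Rightarrow\ 0\in E}}2^{|E|}N_E,\] where $E+1=\{e+1: e\in E\}$.
   Context: $\mathfrak{B}_n$ is the group of signed permutations (bijections $\pi$ of $\{-n,\dots,n\}$ with $\pi(-i)=-\pi(i)$), written as words, with $\pi(0)=0$. $\operatorname{Pe}_B(\pi)$ is the set of $i\in\{1,\dots,n-1\}$ with $\pi(i-1)<\pi(i)>\pi(i+1)$. Work in formal power series in commuting variables $z_0,z_1,z_2,\dots$. For $E=\{e_1<\dots<e_m\}\subseteq\{0,\dots,n-1\}$ put $e_{m+1}=n$ and $N_E=\sum_{0<i_1<\dots<i_m}z_0^{e_1}\prod_{r=1}^m z_{i_r}^{e_{r+1}-e_r}$ (so $N_\emptyset=z_0^n$). Let $Z$ be the totally ordered set $0<\bar1<1<\bar2<2<\cdots$, with $0$ and unbarred $j$ "plus-type" and barred $\bar j$ "minus-type", and $|0|=0$, $|\bar j|=|j|=j$. Define $\mathfrak{d}_B(\pi)=\sum\prod_{s=1}^n z_{|a_s|}$, the sum over all sequences $(a_1,\dots,a_n)\in Z^n$ such that, with $a_0=0$, $a_0\le a_1\le\dots\le a_n$ and for each $s\in\{0,\dots,n-1\}$: if $\pi(s)<\pi(s+1)$ then $a_s<a_{s+1}$ or ($a_s=a_{s+1}$ is plus-type); if $\pi(s)>\pi(s+1)$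 then $a_s<a_{s+1}$ or ($a_s=a_{s+1}$ is minus-type). *)

theory Defs
  imports "HOL-Combinatorics.Permutations"
begin

text \<open>Formal power series in commuting variables z_0, z_1, ... with natural coefficients
  are represented by their coefficient functions: a monomial is its exponent vector
  (type nat \<Rightarrow> nat, the exponent of z_j being the value at j), and a series is
  a map from monomials to coefficients.  Equality of series is equality of these maps.\<close>

type_synonym monomial = "nat \<Rightarrow> nat"
type_synonym pseries = "monomial \<Rightarrow> nat"

definition gf :: "'a set \<Rightarrow> ('a \<Rightarrow> monomial) \<Rightarrow> pseries" where
  "gf A w = (\<lambda>m. card {x \<in> A. w x = m})"

definition signed_perm :: "nat \<Rightarrow> (int \<Rightarrow> int) \<Rightarrow> bool" where
  "signed_perm n \<pi> \<longleftrightarrow> \<pi> permutes {- int n .. int n} \<and> (\<forall>i. \<pi> (- i) = - \<pi> i)"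

definition PeB :: "nat \<Rightarrow> (int \<Rightarrow> int) \<Rightarrow> nat set" where
  "PeB n \<pi> = {i. 1 \<le> i \<and> i \<le> n - 1 \<and> \<pi> (int i - 1) < \<pi> (int i) \<and> \<pi> (int i) > \<pi> (int i + 1)}"

text \<open>The totally ordered set Z = 0 < 1bar < 1 < 2bar < 2 < ... is encoded by nat:
  code 0 is 0, code 2j-1 is jbar, code 2j is j.  Plus-type = even code,
  minus-type = odd code, absolute value |c| = (c+1) div 2.\<close>
definition zabs :: "nat \<Rightarrow> nat" where "zabs c = (c + 1) div 2"
definition plus_type :: "nat \<Rightarrow> bool" where "plus_type c \<longleftrightarrow> even c"
definition minus_type :: "nat \<Rightarrow> bool" where "minus_type c \<longleftrightarrow> odd c"

definition dB_seqs :: "nat \<Rightarrow> (int \<Rightarrow> int) \<Rightarrow> (nat \<Rightarrow> nat) set" where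
  "dB_seqs n \<pi> = {a. a 0 = 0 \<and> (\<forall>s>n. a s = 0) \<and> (\<forall>s<n. a s \<le> a (Suc s)) \<and>
     (\<forall>s<n. (\<pi> (int s) < \<pi> (int s + 1) \<longrightarrow>
                 a s < a (Suc s) \<or> (a s = a (Suc s) \<and> plus_type (a s))) \<and>
             (\<pi> (int s) > \<pi> (int s + 1) \<longrightarrow>
                 a s < a (Suc s) \<or> (a s = a (Suc s) \<and> minus_type (a s))))}"

definition dB_weight :: "nat \<Rightarrow> (nat \<Rightarrow> nat) \<Rightarrow> monomial" where
  "dB_weight n a = (\<lambda>j. card {s \<in> {1..n}. zabs (a s) = j})"

definition dB :: "nat \<Rightarrow> (int \<Rightarrow> int) \<Rightarrow> pseries" where
  "dB n \<pi> = gf (dB_seqs n \<pi>) (dB_weight n)"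

definition Eelem :: "nat \<Rightarrow> nat set \<Rightarrow> nat \<Rightarrow> nat" where
  "Eelem n E r = (if 1 \<le> r \<and> r \<le> card E then sorted_list_of_set E ! (r - 1) else n)"

definition N_idx :: "nat set \<Rightarrow> (nat \<Rightarrow> nat) set" where
  "N_idx E = {i. (\<forall>r. (r < 1 \<or> r > card E) \<longrightarrow> i r = 0) \<and> (\<forall>r\<in>{1..card E}. 0 < i r) \<and>
      (\<forall>r\<in>{1..card E}. \<forall>r'\<in>{1..card E}. r < r' \<longrightarrow> i r < i r')}"

definition N_weight :: "nat \<Rightarrow> nat set \<Rightarrow> (nat \<Rightarrow> nat) \<Rightarrow> monomial" where
  "N_weight n E i = (\<lambda>j. (if j = 0 then Eelem n E 1 else 0) +
      (\<Sum>r\<in>{1..card E}. if i r = j then Eelem n E (r + 1) - Eelem n E r else 0))"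

definition NE :: "nat \<Rightarrow> nat set \<Rightarrow> pseries" where
  "NE n E = gf (N_idx E) (N_weight n E)"

end

theory Submission
  imports Defs
begin

text \<open>Forgetting the bars sends a sequence \<open>a\<close> to the weakly increasing sequence
  \<open>b = \<bar>a\<bar>\<close>, and \<open>N\<^sub>E\<close> enumerates the \<open>b\<close> whose set of strict ascents is \<open>E\<close>. The admissible
  lifts of such a \<open>b\<close> are the choices of the set \<open>P\<close> of plus-type positions in which every
  \<open>s \<notin> E\<close> forces one position: \<open>s + 1 \<in> P\<close> if \<open>\<pi>(s) < \<pi>(s + 1)\<close>, and \<open>s \<notin> P\<close> otherwise. Two such
  requirements clash exactly at a peak outside \<open>E \<union> (E + 1)\<close>, or at position 0 when \<open>\<pi>(1) < 0\<close>
  and \<open>0 \<notin> E\<close>; if they do not clash, the \<open>n - |E|\<close> forced positions are distinct, so \<open>|E|\<close> of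
  the positions \<open>1, \<dots>, n\<close> remain free, whence the factor \<open>2^|E|\<close>.\<close>

section \<open>Absolute values, sign choices and blocks\<close>

definition asc_steps :: "nat \<Rightarrow> (nat \<Rightarrow> nat) \<Rightarrow> nat set" where
  "asc_steps n b = {s. s < n \<and> b s < b (Suc s)}"

text \<open>The value 0 at index 0 and beyond \<open>n\<close> gives each word
  \<open>b 1, ..., b n\<close> a unique function, so counting functions counts words.\<close>

definition incr_seqs :: "nat \<Rightarrow> (nat \<Rightarrow> nat) set" where
  "incr_seqs n = {b. b 0 = 0 \<and> (\<forall>s>n. b s = 0) \<and> (\<forall>s<n. b s \<le> b (Suc s))}"

definition content :: "nat \<Rightarrow> (nat \<Rightarrow> nat) \<Rightarrow> monomial" where
  "content n b = (\<lambda>j. card {s \<in> {1..n}. b s = j})"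

text \<open>\<open>A s\<close> stands for an ascent of the permutation at step \<open>s\<close>. The
  condition \<open>0 \<in> P\<close> records that the initial letter 0 is of plus type.\<close>

definition plus_sets :: "nat \<Rightarrow> (nat \<Rightarrow> bool) \<Rightarrow> nat set \<Rightarrow> nat set set" where
  "plus_sets n A E = {P. P \<subseteq> {0..n} \<and> 0 \<in> P \<and>
     (\<forall>s<n. s \<notin> E \<longrightarrow> (if A s then Suc s \<in> P else s \<notin> P))}"

definition admissible :: "nat \<Rightarrow> (nat \<Rightarrow> bool) \<Rightarrow> nat set \<Rightarrow> bool" where
  "admissible n A E \<longleftrightarrow> (\<forall>s. Suc s < n \<longrightarrow> A s \<longrightarrow> \<not> A (Suc s) \<longrightarrow> s \<in> E \<or> Suc s \<in> E) \<and>
     (0 < n \<longrightarrow> \<not> A 0 \<longrightarrow> 0 \<in> E)"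

text \<open>The number of the block containing \<open>s\<close>: a sequence in
  \<open>incr_seqs n\<close> with ascent set \<open>E\<close> is, on \<open>{0..n}\<close>, a
  function of this count.\<close>

definition count_below :: "nat set \<Rightarrow> nat \<Rightarrow> nat" where
  "count_below E s = card {e \<in> E. e < s}"

subsection \<open>Choices of plus-type positions\<close>

lemma card_set_interval:
  assumes "finite B" "A \<subseteq> B"
  shows "card {P. A \<subseteq> P \<and> P \<subseteq> B} = 2 ^ (card B - card A)"
proof -
  have "bij_betw (\<lambda>Q. A \<union> Q) (Pow (B - A)) {P. A \<subseteq> P \<and> P \<subseteq> B}"
    by (rule bij_betw_byWitness[where f' = "\<lambda>P. P - A"]) (use assms in auto)
  then have "card {P. A \<subseteq> P \<and> P \<subseteq> B} = card (Pow (B - A))"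
    by (simp add: bij_betw_same_card)
  then show ?thesis
    using assms by (simp add: card_Pow card_Diff_subset finite_subset)
qed

lemma plus_sets_empty:
  assumes "\<not> admissible n A E"
  shows "plus_sets n A E = {}"
proof (rule ccontr)
  assume "plus_sets n A E \<noteq> {}"
  then obtain P where P: "P \<in> plus_sets n A E" by blast
  have forced: "if A s then Suc s \<in> P else s \<notin> P" if "s < n" "s \<notin> E" for s
    using P that unfolding plus_sets_def by blast
  have "0 \<in> P" using P unfolding plus_sets_def by blast
  then have "admissible n A E"
    unfolding admissible_def using forced by (metis Suc_lessD)
  with assms show False by blast
qed

lemma card_plus_sets:
  assumes E: "E \<subseteq> {0..<n}"
  shows "card (plus_sets n A E) = (if admissible n A E then 2 ^ card E else 0)"
proof (cases "admissible n A E")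
  case adm: True
  define S where "S = {0..<n} - E"
  \<comment> \<open>The position whose sign is decided by step \<open>s\<close>.\<close>
  define f where "f s = (if A s then Suc s else s)" for s
  define U where "U = f ` {s \<in> S. A s}"
  define V where "V = f ` {s \<in> S. \<not> A s}"
  \<comment> \<open>If \<open>f s = f t\<close> with \<open>s < t\<close>, then
    \<open>t = Suc s\<close>, \<open>A s\<close> and \<open>\<not> A t\<close>;
    \<open>admissible\<close> rules this out when both steps lie outside \<open>E\<close>.\<close>
  have inj: "inj_on f S"
    using adm unfolding inj_on_def f_def S_def admissible_def
    by (auto split: if_splits)
  have UV: "U \<inter> V = {}"
    using inj unfolding U_def V_def inj_on_def by auto
  have zero: "0 \<notin> U" "0 \<notin> V"
    using adm unfolding U_def V_def S_def f_def admissible_def by auto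
  have sub: "U \<subseteq> {0..n}" "V \<subseteq> {0..n}"
    unfolding U_def V_def S_def f_def by auto
  have fin: "finite U" "finite V" using sub finite_subset by blast+
  have "card U + card V = card (f ` S)"
  proof -
    have "f ` S = U \<union> V" unfolding U_def V_def by auto
    then show ?thesis using card_Un_disjoint[OF fin UV] by simp
  qed
  also have "\<dots> = n - card E"
    using inj E by (simp add: card_image S_def card_Diff_subset finite_subset)
  finally have count: "card U + card V = n - card E" .
  have "card E \<le> n" using card_mono[OF _ E] by simp
  have "plus_sets n A E = {P. insert 0 U \<subseteq> P \<and> P \<subseteq> {0..n} - V}"
    unfolding plus_sets_def U_def V_def S_def f_def by auto
  moreover have "insert 0 U \<subseteq> {0..n} - V" using sub zero UV by auto
  ultimately have "card (plus_sets n A E) = 2 ^ (card ({0..n} - V) - card (insert 0 U))"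
    by (simp only: card_set_interval finite_Diff finite_atLeastAtMost)
  \<comment> \<open>Of the \<open>n + 1\<close> positions, 0 is fixed as plus and
    \<open>n - card E\<close> further ones are decided by \<open>U\<close> and
    \<open>V\<close>.\<close>
  also have "card ({0..n} - V) - card (insert 0 U) = card E"
    using count \<open>card E \<le> n\<close> fin sub zero by (simp add: card_Diff_subset)
  finally show ?thesis using adm by simp
qed (simp add: plus_sets_empty)

subsection \<open>Increasing sequences with a prescribed set of strict ascents\<close>

text \<open>The elements of \<open>E\<close> below \<open>s\<close> form an initial segment of its
  sorted list. For \<open>r = card E + 1\<close> the default value \<open>n\<close> of
  \<open>Eelem\<close> is not below \<open>s\<close>, since \<open>s \<le> n\<close>, so the last
  block needs no separate treatment.\<close>

lemma Eelem_less_iff: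
  assumes E: "E \<subseteq> {0..<n}" and r: "1 \<le> r" "r \<le> card E + 1" and s: "s \<le> n"
  shows "Eelem n E r < s \<longleftrightarrow> r \<le> count_below E s"
proof -
  have fin: "finite E" using E finite_subset by blast
  define L where "L = sorted_list_of_set E"
  have len: "length L = card E" and setL: "set L = E"
    and sortL: "sorted_wrt (<) L"
    unfolding L_def using fin by auto
  have mono: "L ! k < L ! l" if "k < l" "l < card E" for k l
    using sortL that len by (simp add: sorted_wrt_iff_nth_less)
  have inj: "inj_on ((!) L) {..<card E}"
    by (rule inj_onI) (metis lessThan_iff mono less_irrefl linorder_neqE_nat)
  define K where "K = {k. k < card E \<and> L ! k < s}"
  have "e \<in> E \<longleftrightarrow> (\<exists>k<card E. e = L ! k)" for e
    using setL len by (metis in_set_conv_nth)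
  then have "{e \<in> E. e < s} = (!) L ` K"
    unfolding K_def by auto
  moreover have "inj_on ((!) L) K" using inj by (rule inj_on_subset) (auto simp: K_def)
  ultimately have cK: "count_below E s = card K"
    unfolding count_below_def by (simp add: card_image)
  show ?thesis
  proof (cases "r \<le> card E")
    case True
    have El: "Eelem n E r = L ! (r - 1)" unfolding Eelem_def L_def using r True by simp
    show ?thesis
    proof
      assume less: "Eelem n E r < s"
      have "k \<in> K" if "k < r" for k
      proof -
        have "L ! k \<le> L ! (r - 1)"
        proof (cases "k = r - 1")
          case False
          then have "k < r - 1" "r - 1 < card E" using that True by linarith+
          then show ?thesis using mono less_imp_le by blast
        qed simp
        then show ?thesis using that True less unfolding K_def El by simp
      qed
      then have "{..<r} \<subseteq> K" by auto
      moreover have "finite K" unfolding K_def by simp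
      ultimately show "r \<le> count_below E s" using card_mono[of K "{..<r}"] cK by simp
    next
      assume le: "r \<le> count_below E s"
      show "Eelem n E r < s"
      proof (rule ccontr)
        assume "\<not> Eelem n E r < s"
        \<comment> \<open>By monotonicity of \<open>L\<close>, no index from \<open>r - 1\<close> on
          lies in \<open>K\<close>, which leaves \<open>K\<close> too small.\<close>
        then have "k < r - 1" if "k \<in> K" for k
          using that mono[of "r - 1" k] unfolding K_def El
          by (cases k "r - 1" rule: linorder_cases) (auto simp: not_less)
        then have "K \<subseteq> {..<r - 1}" by auto
        then have "card K \<le> r - 1" using card_mono[of "{..<r - 1}" K] by simp
        with le r cK show False by simp
      qed
    qed
  next
    case False
    have "count_below E s \<le> card E"
      unfolding count_below_def using fin by (intro card_mono) auto
    then show ?thesis using False s by (simp add: Eelem_def)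
  qed
qed

lemma count_below_0 [simp]: "count_below E 0 = 0"
  by (simp add: count_below_def)

lemma count_below_Suc:
  assumes "finite E"
  shows "count_below E (Suc s) = (if s \<in> E then Suc (count_below E s) else count_below E s)"
proof -
  have "{e \<in> E. e < Suc s} = (if s \<in> E then insert s {e \<in> E. e < s} else {e \<in> E. e < s})"
    by (auto simp: less_Suc_eq)
  then show ?thesis using assms by (simp add: count_below_def)
qed

lemma count_below_le: "finite E \<Longrightarrow> count_below E s \<le> card E"
  unfolding count_below_def by (intro card_mono) auto

lemma Eelem_le:
  assumes "E \<subseteq> {0..<n}"
  shows "Eelem n E r \<le> n"
proof (cases "1 \<le> r \<and> r \<le> card E")
  case True
  have "finite E" using assms finite_subset by blast
  then have "sorted_list_of_set E ! (r - 1) \<in> E"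
    using True by (metis Suc_le_eq Suc_diff_1 nth_mem set_sorted_list_of_set
        length_sorted_list_of_set less_le_trans zero_less_one)
  then show ?thesis using assms True by (auto simp: Eelem_def)
qed (auto simp: Eelem_def)

lemma Eelem_mem:
  assumes "E \<subseteq> {0..<n}" "1 \<le> r" "r \<le> card E"
  shows "Eelem n E r \<in> E"
proof -
  have "finite E" using assms finite_subset by blast
  moreover have "r - 1 < length (sorted_list_of_set E)" using assms by simp
  ultimately have "sorted_list_of_set E ! (r - 1) \<in> E"
    using nth_mem set_sorted_list_of_set by metis
  then show ?thesis using assms by (simp add: Eelem_def)
qed

text \<open>The count jumps from \<open>r - 1\<close> to \<open>r\<close> in passing the
  \<open>r\<close>-th element of \<open>E\<close>, so the next position opens block
  \<open>r\<close>.\<close>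

lemma count_below_Suc_Eelem:
  assumes E: "E \<subseteq> {0..<n}" and r: "1 \<le> r" "r \<le> card E"
  shows "count_below E (Suc (Eelem n E r)) = r"
proof -
  have fin: "finite E" using E finite_subset by blast
  have mem: "Eelem n E r \<in> E" using Eelem_mem[OF E r] .
  then have "Suc (Eelem n E r) \<le> n" using E by auto
  then have "r \<le> count_below E (Suc (Eelem n E r))"
    using Eelem_less_iff[OF E, of r "Suc (Eelem n E r)"] r by simp
  moreover have "\<not> r \<le> count_below E (Eelem n E r)"
    using Eelem_less_iff[OF E, of r "Eelem n E r"] r Eelem_le[OF E] by simp
  ultimately show ?thesis using count_below_Suc[OF fin] mem by simp
qed

text \<open>Block \<open>r\<close> runs from \<open>Eelem n E r\<close>, excluded, to
  \<open>Eelem n E (r + 1)\<close>, included; block 0 starts at 1. The lengths are the exponents in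
  N_E.\<close>

lemma card_count_below:
  assumes E: "E \<subseteq> {0..<n}" and r: "r \<le> card E"
  shows "card {s \<in> {1..n}. count_below E s = r} =
    (if r = 0 then Eelem n E 1 else Eelem n E (r + 1) - Eelem n E r)"
proof (cases "r = 0")
  case True
  have "{s \<in> {1..n}. count_below E s = 0} = {1..Eelem n E 1}"
  proof (rule set_eqI)
    fix s
    show "s \<in> {s \<in> {1..n}. count_below E s = 0} \<longleftrightarrow> s \<in> {1..Eelem n E 1}"
      using Eelem_less_iff[OF E, of 1 s] Eelem_le[OF E, of 1] by (cases "s \<le> n") auto
  qed
  then show ?thesis using True by simp
next
  case False
  have "{s \<in> {1..n}. count_below E s = r} = {Eelem n E r<..Eelem n E (r + 1)}"
  proof (rule set_eqI)
    fix s
    show "s \<in> {s \<in> {1..n}. count_below E s = r} \<longleftrightarrow> s \<in> {Eelem n E r<..Eelem n E (r + 1)}"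
      using Eelem_less_iff[OF E, of r s] Eelem_less_iff[OF E, of "r + 1" s]
        Eelem_le[OF E, of "r + 1"] False r by (cases "s \<le> n") auto
  qed
  then show ?thesis using False by simp
qed

text \<open>The sequence is constantly \<open>i r\<close> on block \<open>r\<close>, which
  contributes a power of the variable with that index. With \<open>i 0 = 0\<close>, block 0 yields
  the separate factor in z_0.\<close>

lemma content_count_below:
  assumes E: "E \<subseteq> {0..<n}" and i0: "i 0 = 0"
  shows "content n (\<lambda>s. if s \<le> n then i (count_below E s) else 0) = N_weight n E i"
proof
  fix j
  let ?c = "count_below E"
  have fin: "finite E" using E finite_subset by blast
  have "{s \<in> {1..n}. (if s \<le> n then i (?c s) else 0) = j} =
      (\<Union>r\<in>{r \<in> {0..card E}. i r = j}. {s \<in> {1..n}. ?c s = r})"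
    using count_below_le[OF fin] by auto
  then have "content n (\<lambda>s. if s \<le> n then i (?c s) else 0) j =
      card (\<Union>r\<in>{r \<in> {0..card E}. i r = j}. {s \<in> {1..n}. ?c s = r})"
    by (simp add: content_def)
  also have "\<dots> = (\<Sum>r\<in>{r \<in> {0..card E}. i r = j}. card {s \<in> {1..n}. ?c s = r})"
    by (rule card_UN_disjoint) auto
  also have "\<dots> = (\<Sum>r\<in>{0..card E}. if i r = j then card {s \<in> {1..n}. ?c s = r} else 0)"
    by (rule sum.inter_filter) simp
  also have "\<dots> = (if i 0 = j then card {s \<in> {1..n}. ?c s = 0} else 0) +
      (\<Sum>r\<in>{1..card E}. if i r = j then card {s \<in> {1..n}. ?c s = r} else 0)"
    by (simp add: sum.atLeast_Suc_atMost)
  also have "\<dots> = N_weight n E i j"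
    unfolding N_weight_def
  proof (intro arg_cong2[where f = "(+)"] sum.cong refl)
    show "(if i 0 = j then card {s \<in> {1..n}. ?c s = 0} else 0) =
        (if j = 0 then Eelem n E 1 else 0)"
      unfolding card_count_below[OF E le0] i0 by auto
    fix r assume r: "r \<in> {1..card E}"
    then have "card {s \<in> {1..n}. ?c s = r} = Eelem n E (r + 1) - Eelem n E r"
      using card_count_below[OF E, of r] by (metis atLeastAtMost_iff not_one_le_zero)
    then show "(if i r = j then card {s \<in> {1..n}. ?c s = r} else 0) =
        (if i r = j then Eelem n E (r + 1) - Eelem n E r else 0)"
      by (simp only:)
  qed
  finally show "content n (\<lambda>s. if s \<le> n then i (?c s) else 0) j = N_weight n E i j" .
qed

text \<open>Equal counts mean that no element of \<open>E\<close> lies in \<open>{s..<t}\<close>, so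
  no step in between changes \<open>b\<close>.\<close>

lemma eq_if_count_below_eq:
  assumes b: "\<And>s. s < n \<Longrightarrow> s \<notin> E \<Longrightarrow> b (Suc s) = b s" and fin: "finite E"
    and "s \<le> t" "t \<le> n" "count_below E s = count_below E t"
  shows "b s = b t"
  using assms(3,4,5)
proof (induction t rule: dec_induct)
  case base
  then show ?case by simp
next
  case (step t)
  have "count_below E s \<le> count_below E t"
    unfolding count_below_def using fin step by (intro card_mono) auto
  then have "t \<notin> E" "count_below E s = count_below E t"
    using step.prems count_below_Suc[OF fin, of t] by (auto split: if_splits)
  then show ?case using step b[of t] by simp
qed

text \<open>Two mutually inverse maps: \<open>F\<close> spreads the indices over the blocks, and
  \<open>G\<close> reads a sequence at the first position of each block after block 0.\<close>

lemma NE_eq_card_incr_seqs: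
  assumes E: "E \<subseteq> {0..<n}"
  shows "NE n E m = card {b \<in> incr_seqs n. content n b = m \<and> asc_steps n b = E}"
proof -
  have fin: "finite E" using E finite_subset by blast
  let ?c = "count_below E"
  define F where "F i = (\<lambda>s. if s \<le> n then i (?c s) else 0)" for i :: "nat \<Rightarrow> nat"
  define G where "G b = (\<lambda>r. if 1 \<le> r \<and> r \<le> card E then b (Suc (Eelem n E r)) else 0)"
    for b :: "nat \<Rightarrow> nat"
  have i0: "i 0 = 0" if "i \<in> N_idx E" for i
    using that unfolding N_idx_def by blast
  have weight: "content n (F i) = N_weight n E i" if "i \<in> N_idx E" for i
    unfolding F_def using content_count_below[where i = i, OF E i0[OF that]] .
  have GF: "G (F i) = i" if i: "i \<in> N_idx E" for i
  proof
    fix r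
    show "G (F i) r = i r"
    proof (cases "1 \<le> r \<and> r \<le> card E")
      case True
      then have "Suc (Eelem n E r) \<le> n" using Eelem_mem[OF E, of r] E by auto
      then show ?thesis
        using True count_below_Suc_Eelem[OF E, of r] by (simp add: G_def F_def)
    next
      case False
      then have "i r = 0" using i unfolding N_idx_def
        by (metis (mono_tags, lifting) mem_Collect_eq not_le)
      then show ?thesis using False by (auto simp: G_def)
    qed
  qed
  have F_mem: "F i \<in> incr_seqs n \<and> asc_steps n (F i) = E" if i: "i \<in> N_idx E" for i
  proof -
    \<comment> \<open>The case \<open>r = 0\<close> compares the default \<open>i 0 = 0\<close> with
      a positive first index; it makes the jump at the smallest element of \<open>E\<close>
      strict.\<close>
    have step: "i r < i (Suc r)" if "Suc r \<le> card E" for r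
    proof (cases "r = 0")
      case True
      then show ?thesis using i that i0[OF i] unfolding N_idx_def by auto
    next
      case False
      then show ?thesis using i that unfolding N_idx_def by auto
    qed
    have F_Suc: "if s \<in> E then F i s < F i (Suc s) else F i s = F i (Suc s)" if "s < n" for s
      using that step[of "?c s"] count_below_Suc[OF fin, of s] count_below_le[OF fin, of "Suc s"]
      by (auto simp: F_def)
    then have "asc_steps n (F i) = E"
      using E unfolding asc_steps_def by (fastforce split: if_splits)
    moreover have "F i \<in> incr_seqs n"
      unfolding incr_seqs_def
    proof (intro CollectI conjI allI impI)
      show "F i 0 = 0" by (simp add: F_def i0[OF i])
      show "F i s = 0" if "n < s" for s using that by (simp add: F_def)
      show "F i s \<le> F i (Suc s)" if "s < n" for s
        using F_Suc[OF that] by (auto split: if_splits)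
    qed
    ultimately show ?thesis by blast
  qed
  have G_mem: "G b \<in> N_idx E \<and> F (G b) = b"
    if b: "b \<in> incr_seqs n" and stp: "asc_steps n b = E" for b
  proof
    have const: "b (Suc s) = b s" if "s < n" "s \<notin> E" for s
      using b that stp unfolding incr_seqs_def asc_steps_def by fastforce
    have mono: "b s \<le> b t" if "s \<le> t" "t \<le> n" for s t
      using that
    proof (induction t rule: dec_induct)
      case (step t)
      then show ?case using b unfolding incr_seqs_def
        by (metis (mono_tags, lifting) Suc_le_eq le_trans less_imp_le mem_Collect_eq)
    qed simp
    have b_Eelem: "b (Eelem n E r) < b (Suc (Eelem n E r))" if "1 \<le> r" "r \<le> card E" for r
      using Eelem_mem[OF E that] stp unfolding asc_steps_def by blast
    \<comment> \<open>With e and e' for the \<open>r\<close>-th and \<open>r'\<close>-th elements of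
      \<open>E\<close>, the chain is \<open>b (e + 1) \<le> b e' < b (e' + 1)\<close>; its strict
      part is the ascent at e'.\<close>
    have "b (Suc (Eelem n E r)) < b (Suc (Eelem n E r'))"
      if "1 \<le> r" "r < r'" "r' \<le> card E" for r r'
    proof -
      have "Eelem n E r < n" using Eelem_mem[OF E, of r] that E by auto
      moreover have "\<not> Eelem n E r' < Suc (Eelem n E r)"
        using Eelem_less_iff[OF E, of r' "Suc (Eelem n E r)"] count_below_Suc_Eelem[OF E, of r]
          calculation that by simp
      ultimately show ?thesis
        using mono[of "Suc (Eelem n E r)" "Eelem n E r'"] b_Eelem[of r'] that Eelem_le[OF E, of r']
        by simp
    qed
    moreover have "0 < b (Suc (Eelem n E r))" if "1 \<le> r" "r \<le> card E" for r
      using b_Eelem[OF that] by simp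
    ultimately show "G b \<in> N_idx E"
      unfolding N_idx_def G_def by auto
    show "F (G b) = b"
    proof
      fix s
      \<comment> \<open>Past \<open>n\<close> both sides are 0; block 0 keeps the start value
        \<open>b 0 = 0\<close>; in a later block, \<open>s\<close> is compared with the first
        position.\<close>
      consider "n < s" | "s \<le> n" "?c s = 0" | "s \<le> n" "1 \<le> ?c s" by linarith
      then show "F (G b) s = b s"
      proof cases
        case 1
        then show ?thesis using b by (simp add: F_def incr_seqs_def)
      next
        case 2
        then have "b 0 = b s"
          using eq_if_count_below_eq[of n E b 0 s] const fin by simp
        then show ?thesis using 2 b by (simp add: F_def G_def incr_seqs_def)
      next
        case 3
        let ?t = "Suc (Eelem n E (?c s))"
        have r: "?c s \<le> card E" using count_below_le[OF fin] .
        have "?t \<le> s" using Eelem_less_iff[OF E, of "?c s" s] 3 r by simp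
        then have "b ?t = b s"
          using eq_if_count_below_eq[of n E b ?t s] const fin 3
            count_below_Suc_Eelem[OF E 3(2) r] by simp
        then show ?thesis using 3 r by (simp add: F_def G_def)
      qed
    qed
  qed
  have "bij_betw F {i \<in> N_idx E. N_weight n E i = m}
      {b \<in> incr_seqs n. content n b = m \<and> asc_steps n b = E}"
  proof (rule bij_betw_byWitness[where f' = G])
    show "G ` {b \<in> incr_seqs n. content n b = m \<and> asc_steps n b = E}
        \<subseteq> {i \<in> N_idx E. N_weight n E i = m}"
      using G_mem weight by (smt (verit) image_subsetI mem_Collect_eq)
  qed (use GF F_mem G_mem weight in auto)
  then show ?thesis
    unfolding NE_def gf_def by (rule bij_betw_same_card)
qed

text \<open>The content determines which values occur at positions 1 to \<open>n\<close>, so all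
  these sequences share the finite range of one of them. Finiteness later turns the count of pairs
  into a sum over \<open>b\<close>.\<close>

lemma finite_incr_seqs_content: "finite {b \<in> incr_seqs n. content n b = m}"
proof (cases "{b \<in> incr_seqs n. content n b = m} = {}")
  case False
  then obtain b0 where b0: "content n b0 = m" by blast
  have range: "b s \<in> b0 ` {1..n}" if "content n b = m" "s \<in> {1..n}" for b s
  proof -
    have "content n b (b s) \<noteq> 0"
      using that(2) unfolding content_def by auto
    then have "content n b0 (b s) \<noteq> 0" using that b0 by simp
    then have "{t \<in> {1..n}. b0 t = b s} \<noteq> {}"
      unfolding content_def by (metis card.empty)
    then show ?thesis by force
  qed
  have "{b \<in> incr_seqs n. content n b = m} \<subseteq>
      {b. \<forall>s. (s \<in> {1..n} \<longrightarrow> b s \<in> b0 ` {1..n}) \<and> (s \<notin> {1..n} \<longrightarrow> b s = 0)}"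
  proof safe
    fix b s
    assume b: "b \<in> incr_seqs n"
    { assume "s \<in> {1..n}" "m = content n b"
      then show "b s \<in> b0 ` {1..n}" using range by simp }
    { assume "s \<notin> {1..n}"
      then have "s = 0 \<or> s > n" by auto
      then show "b s = 0" using b by (auto simp: incr_seqs_def) }
  qed
  then show ?thesis
    by (rule finite_subset) (intro finite_set_of_finite_funs; simp)
qed (simp only: finite.emptyI)

subsection \<open>Splitting a sequence into absolute values and signs\<close>

text \<open>Codes with common absolute value j > 0 are \<open>2 * j - 1\<close> and
  \<open>2 * j\<close>. For \<open>x \<le> y\<close> among them, an ascent excludes only
  \<open>x = y = 2 * j - 1\<close>, leaving \<open>y\<close> even; a descent excludes only
  \<open>x = y = 2 * j\<close>, leaving \<open>x\<close> odd. Hence an ascent constrains the later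
  position and a descent the earlier one. For j = 0 only \<open>x = y = 0\<close> remains, which is
  even.\<close>

lemma zabs_step_iff:
  "x \<le> y \<and> (A \<longrightarrow> x < y \<or> x = y \<and> even x) \<and> (\<not> A \<longrightarrow> x < y \<or> x = y \<and> odd x) \<longleftrightarrow>
   zabs x \<le> zabs y \<and> (\<not> zabs x < zabs y \<longrightarrow> (if A then even y else odd x))"
  unfolding zabs_def by (cases A; simp; presburger)

lemma zabs_eq_0_iff: "zabs c = 0 \<longleftrightarrow> c = 0"
  unfolding zabs_def by presburger

lemma dB_seqs_iff:
  assumes A: "\<And>s. A s \<longleftrightarrow> \<pi> (int s) < \<pi> (int s + 1)" and "inj \<pi>"
  shows "a \<in> dB_seqs n \<pi> \<longleftrightarrow> zabs \<circ> a \<in> incr_seqs n \<and>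
    (\<forall>s<n. s \<notin> asc_steps n (zabs \<circ> a) \<longrightarrow> (if A s then even (a (Suc s)) else odd (a s)))"
proof -
  \<comment> \<open>Injectivity excludes equal neighbouring values, so a step that is not an ascent
    is a descent.\<close>
  have desc: "\<pi> (int s) > \<pi> (int s + 1) \<longleftrightarrow> \<not> A s" for s
    using A[of s] injD[OF \<open>inj \<pi>\<close>, of "int s" "int s + 1"] by linarith
  have "a \<in> dB_seqs n \<pi> \<longleftrightarrow> a 0 = 0 \<and> (\<forall>s>n. a s = 0) \<and>
    (\<forall>s<n. a s \<le> a (Suc s) \<and> (A s \<longrightarrow> a s < a (Suc s) \<or> a s = a (Suc s) \<and> even (a s)) \<and>
      (\<not> A s \<longrightarrow> a s < a (Suc s) \<or> a s = a (Suc s) \<and> odd (a s)))"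
    unfolding dB_seqs_def plus_type_def minus_type_def desc A[symmetric] by blast
  then show ?thesis
    unfolding zabs_step_iff incr_seqs_def asc_steps_def by (auto simp: zabs_eq_0_iff)
qed

lemma dB_eq_card_Sigma:
  assumes A: "\<And>s. A s \<longleftrightarrow> \<pi> (int s) < \<pi> (int s + 1)" and inj: "inj \<pi>"
  shows "dB n \<pi> m =
    card (SIGMA b:{b \<in> incr_seqs n. content n b = m}. plus_sets n A (asc_steps n b))"
proof -
  \<comment> \<open>The codes are \<open>2 * j\<close> for plus and \<open>2 * j - 1\<close> for
    minus. Truncated subtraction sends the value 0 to code 0 in either case, which also covers the
    positions beyond \<open>n\<close>.\<close>
  define F :: "(nat \<Rightarrow> nat) \<times> nat set \<Rightarrow> nat \<Rightarrow> nat"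
    where "F = (\<lambda>(b, P) s. if s \<in> P then 2 * b s else 2 * b s - 1)"
  define G :: "(nat \<Rightarrow> nat) \<Rightarrow> (nat \<Rightarrow> nat) \<times> nat set"
    where "G a = (zabs \<circ> a, {s. s \<le> n \<and> even (a s)})" for a
  let ?D = "{a \<in> dB_seqs n \<pi>. dB_weight n a = m}"
  let ?S = "SIGMA b:{b \<in> incr_seqs n. content n b = m}. plus_sets n A (asc_steps n b)"
  have weight: "dB_weight n a = content n (zabs \<circ> a)" for a
    by (simp add: dB_weight_def content_def)
  have zabs_F: "zabs \<circ> F (b, P) = b" for b P
    by (rule ext) (auto simp: F_def zabs_def)
  have FG: "F (G a) = a" if "a \<in> ?D" for a
  proof
    fix s
    have "s > n \<Longrightarrow> a s = 0" using that by (simp add: dB_seqs_def)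
    then show "F (G a) s = a s"
      by (cases "s \<le> n") (auto simp: F_def G_def zabs_def elim: evenE oddE)
  qed
  have G_mem: "G a \<in> ?S" if "a \<in> ?D" for a
  proof -
    have "a 0 = 0" using that by (simp add: dB_seqs_def)
    then show ?thesis
      using that by (auto simp: G_def weight dB_seqs_iff[OF A inj] plus_sets_def)
  qed
  have lift: "F (b, P) \<in> ?D \<and> G (F (b, P)) = (b, P)" if bP: "(b, P) \<in> ?S" for b P
  proof -
    have b: "b \<in> incr_seqs n" "content n b = m" and P: "P \<in> plus_sets n A (asc_steps n b)"
      using bP by auto
    \<comment> \<open>Absolute value 0 has no minus-type code, so minus positions need a positive
      value. Going left from such a position, either the preceding step is a strict ascent, or the
      preceding position is forced to be minus as well; position 0 cannot be reached, as it lies in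
      \<open>P\<close>.\<close>
    have pos: "b s > 0" if "s \<le> n" "s \<notin> P" for s
      using that
    proof (induction s)
      case 0
      then show ?case using P by (simp add: plus_sets_def)
    next
      case (Suc s)
      then have le: "b s \<le> b (Suc s)" and
        forced: "s \<notin> asc_steps n b \<longrightarrow> (if A s then Suc s \<in> P else s \<notin> P)"
        using b(1) P unfolding incr_seqs_def plus_sets_def Suc_le_eq by blast+
      show ?case
      proof (cases "s \<in> asc_steps n b")
        case True
        then show ?thesis by (simp add: asc_steps_def)
      next
        case False
        then have "s \<notin> P" using forced Suc.prems by (auto split: if_splits)
        then show ?thesis using Suc le by simp
      qed
    qed
    have even_F: "even (F (b, P) s) \<longleftrightarrow> s \<in> P" if "s \<le> n" for s
      using pos[OF that] by (auto simp: F_def)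
    have "P \<subseteq> {0..n}" using P by (simp add: plus_sets_def)
    then have "{s. s \<le> n \<and> even (F (b, P) s)} = P" using even_F by auto
    then have "G (F (b, P)) = (b, P)" by (simp add: G_def zabs_F)
    moreover have "F (b, P) \<in> ?D"
      using b P by (auto simp: weight zabs_F dB_seqs_iff[OF A inj] even_F plus_sets_def)
    ultimately show ?thesis by blast
  qed
  have lift': "F x \<in> ?D \<and> G (F x) = x" if "x \<in> ?S" for x
    using lift[of "fst x" "snd x"] that by (simp only: prod.collapse)
  have "bij_betw G ?D ?S"
  proof (rule bij_betw_byWitness[where f' = F])
    show "\<forall>a\<in>?D. F (G a) = a" using FG by blast
    show "\<forall>x\<in>?S. G (F x) = x" using lift' by blast
    show "G ` ?D \<subseteq> ?S" using G_mem by blast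
    show "F ` ?S \<subseteq> ?D" using lift' by blast
  qed
  then show ?thesis
    unfolding dB_def gf_def by (rule bij_betw_same_card)
qed

section \<open>Clashing requirements and peaks\<close>

lemma admissible_iff_PeB:
  assumes perm: "signed_perm n \<pi>" and inj: "inj \<pi>"
    and A: "\<And>s. A s \<longleftrightarrow> \<pi> (int s) < \<pi> (int s + 1)"
  shows "admissible n A E \<longleftrightarrow>
    PeB n \<pi> \<subseteq> E \<union> (\<lambda>e. e + 1) ` E \<and> (\<pi> 1 < 0 \<longrightarrow> 0 \<in> E)"
proof -
  have perm': "\<pi> permutes {- int n .. int n}" and neg: "\<pi> (- i) = - \<pi> i" for i
    using perm by (auto simp: signed_perm_def)
  have "\<pi> 0 = 0" using neg[of 0] by simp
  have desc: "\<pi> (int s) > \<pi> (int s + 1) \<longleftrightarrow> \<not> A s" for s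
    using A[of s] injD[OF inj, of "int s" "int s + 1"] by linarith
  \<comment> \<open>Indexing a peak by the step \<open>s\<close> leading up to it turns membership
    in \<open>E + 1\<close> into \<open>s \<in> E\<close>.\<close>
  have peak: "Suc s \<in> PeB n \<pi> \<longleftrightarrow> Suc s < n \<and> A s \<and> \<not> A (Suc s)" for s
    unfolding PeB_def desc[symmetric] by (auto simp: A add.commute)
  have "0 \<notin> PeB n \<pi>" by (simp add: PeB_def)
  then have "PeB n \<pi> \<subseteq> E \<union> (\<lambda>e. e + 1) ` E \<longleftrightarrow>
      (\<forall>s. Suc s \<in> PeB n \<pi> \<longrightarrow> s \<in> E \<or> Suc s \<in> E)"
    by (auto simp: subset_iff image_iff) (metis not0_implies_Suc)
  moreover have "\<pi> 1 < 0 \<longleftrightarrow> 0 < n \<and> \<not> A 0"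
  proof (cases "n = 0")
    case True
    \<comment> \<open>For \<open>n = 0\<close> the point 1 is fixed, so \<open>\<pi> 1 = 1\<close>
      is not negative.\<close>
    then show ?thesis using permutes_not_in[OF perm', of 1] by simp
  next
    case False
    then show ?thesis using desc[of 0] \<open>\<pi> 0 = 0\<close> by simp
  qed
  ultimately show ?thesis
    unfolding admissible_def peak by blast
qed

section \<open>Summation over ascent sets\<close>

theorem theorem6p3:
  fixes n :: nat and \<pi> :: "int \<Rightarrow> int"
  assumes "signed_perm n \<pi>"
  shows "dB n \<pi> = (\<lambda>m. \<Sum>E \<in> {E. E \<subseteq> {0..<n} \<and> PeB n \<pi> \<subseteq> E \<union> (\<lambda>e. e + 1) ` E \<and>
                                  (\<pi> 1 < 0 \<longrightarrow> 0 \<in> E)}.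
                       2 ^ card E * NE n E m)"
proof
  fix m
  define A where "A s \<longleftrightarrow> \<pi> (int s) < \<pi> (int s + 1)" for s
  define B where "B = {b \<in> incr_seqs n. content n b = m}"
  have inj: "inj \<pi>" using assms permutes_inj by (auto simp: signed_perm_def)
  have finB: "finite B" unfolding B_def by (rule finite_incr_seqs_content)
  have steps: "asc_steps n b \<in> Pow {0..<n}" for b by (auto simp: asc_steps_def)
  have "dB n \<pi> m = card (SIGMA b:B. plus_sets n A (asc_steps n b))"
    unfolding B_def using dB_eq_card_Sigma[OF A_def inj] .
  also have "\<dots> = (\<Sum>b\<in>B. card (plus_sets n A (asc_steps n b)))"
  proof (rule card_SigmaI[OF finB])
    have "plus_sets n A E \<subseteq> Pow {0..n}" for E by (auto simp: plus_sets_def)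
    then show "\<forall>b\<in>B. finite (plus_sets n A (asc_steps n b))"
      by (meson finite_Pow_iff finite_atLeastAtMost finite_subset)
  qed
  also have "\<dots> = (\<Sum>E\<in>Pow {0..<n}. \<Sum>b\<in>{b \<in> B. asc_steps n b = E}.
      card (plus_sets n A (asc_steps n b)))"
    using finB steps by (intro sum.group[symmetric]) auto
  \<comment> \<open>Within a group the number of sign choices depends only on \<open>E\<close>, and
    the group size is the coefficient of N_E at \<open>m\<close>.\<close>
  also have "\<dots> = (\<Sum>E\<in>Pow {0..<n}. if admissible n A E then 2 ^ card E * NE n E m else 0)"
    by (intro sum.cong)
      (auto simp: card_plus_sets NE_eq_card_incr_seqs B_def conj_assoc)
  also have "\<dots> = (\<Sum>E\<in>{E \<in> Pow {0..<n}. admissible n A E}. 2 ^ card E * NE n E m)"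
    by (rule sum.inter_filter[symmetric]) simp
  also have "{E \<in> Pow {0..<n}. admissible n A E} =
      {E. E \<subseteq> {0..<n} \<and> PeB n \<pi> \<subseteq> E \<union> (\<lambda>e. e + 1) ` E \<and> (\<pi> 1 < 0 \<longrightarrow> 0 \<in> E)}"
    using admissible_iff_PeB[OF assms inj A_def] by auto
  finally show "dB n \<pi> m = (\<Sum>E \<in> {E. E \<subseteq> {0..<n} \<and> PeB n \<pi> \<subseteq> E \<union> (\<lambda>e. e + 1) ` E \<and>
      (\<pi> 1 < 0 \<longrightarrow> 0 \<in> E)}. 2 ^ card E * NE n E m)" .
qed

end
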